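(* Let $n, m, N$ be positive integers and let $t$ be a non-negative integer such that $(t+1)(n-1)(m-1)+1\leq N\leq (t+2)(n-1)(m-1)$. Let $T_n$ be a tree on $n$ vertices, and let $G$ be a graph on $N$ vertices with minimum degree $\delta(G)\geq N-t(n-1)-2$. If $m-2\not\equiv 0\pmod{n-1}$ and $T_n\neq K_{1,n-1}$, then $G\rightarrow (T_n, K_m)$.
   Context: All graphs are finite and simple. For graphs $G, G_1, G_2$, the notation $G\rightarrow (G_1, G_2)$ means that every coloring of the edges of $G$ with two colors, red and blue, yields a red copy of $G_1$ or a blue copy of $G_2$ (copies are as not necessarily induced subgraphs). $K_m$ is the complete graph on $m$ vertices, and $K_{1,n-1}$ is the star on $n$ vertices; $T_n\neq K_{1,n-1}$ means that $T_n$ is not isomorphic to $K_{1,n-1}$. *)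

theory Defs
  imports "Graph_Theory.Graph_Theory" "HOL-Number_Theory.Cong"
begin

text \<open>
  A finite simple graph is a \<^locale>\<open>pair_graph\<close>: a finite vertex set with a symmetric and
  irreflexive set of arcs, the edge \<open>{u, v}\<close> being the pair of arcs \<open>(u, v)\<close> and \<open>(v, u)\<close>.
\<close>

definition min_degree :: "('a, 'b) pre_digraph \<Rightarrow> nat" where
  "min_degree G = Min (out_degree G ` verts G)"

text \<open>
  The constant \<^const>\<open>tree\<close> of the library does not describe trees in this representation:
  \<^const>\<open>pre_digraph.cycle\<close> counts \<open>u, v, u\<close> as a cycle of a symmetric digraph. The cycles of
  the undirected graph are those of length at least 3.
\<close>

definition undirected_tree :: "'a pair_pre_digraph \<Rightarrow> bool" where
  "undirected_tree T \<longleftrightarrow> pair_graph T \<and> connected (with_proj T) \<and>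
     \<not> (\<exists>p. pre_digraph.cycle (with_proj T) p \<and> 3 \<le> length p)"

definition complete_graph :: "nat \<Rightarrow> nat pair_pre_digraph" where
  "complete_graph m =
     \<lparr> pverts = {..<m}, parcs = {(u, v). u < m \<and> v < m \<and> u \<noteq> v} \<rparr>"

text \<open>The star on \<open>n\<close> vertices, that is \<open>K\<^bsub>1,n-1\<^esub>\<close>, with centre 0.\<close>

definition star_graph :: "nat \<Rightarrow> nat pair_pre_digraph" where
  "star_graph n =
     \<lparr> pverts = {..<n}, parcs = {(u, v). u < n \<and> v < n \<and> (u = 0) \<noteq> (v = 0)} \<rparr>"

text \<open>Copies are subgraphs that need not be induced.\<close>

definition contains_copy :: "'a pair_pre_digraph \<Rightarrow> 'b pair_pre_digraph \<Rightarrow> bool" where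
  "contains_copy G H \<longleftrightarrow>
     (\<exists>H'. subgraph (with_proj H') (with_proj G) \<and> digraph_iso (with_proj H) (with_proj H'))"

datatype colour = Red | Blue

text \<open>
  A colouring assigns a colour to the set \<open>{u, v}\<close> of end vertices of an edge, so that the two
  arcs of an edge get the same colour. Its values on other sets are irrelevant.
\<close>

definition colour_class ::
  "'a pair_pre_digraph \<Rightarrow> ('a set \<Rightarrow> colour) \<Rightarrow> colour \<Rightarrow> 'a pair_pre_digraph" where
  "colour_class G c k =
     \<lparr> pverts = pverts G, parcs = {(u, v) \<in> parcs G. c {u, v} = k} \<rparr>"

definition arrows ::
  "'a pair_pre_digraph \<Rightarrow> 'b pair_pre_digraph \<Rightarrow> 'c pair_pre_digraph \<Rightarrow> bool" where
  "arrows G G1 G2 \<longleftrightarrow>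
     (\<forall>c. contains_copy (colour_class G c Red) G1 \<or> contains_copy (colour_class G c Blue) G2)"


lemma pair_graph_colour_class:
  assumes "pair_graph G"
  shows "pair_graph (colour_class G c k)"
proof -
  interpret pair_graph G by fact
  have fin: "finite (parcs (colour_class G c k))"
    by (rule finite_subset[OF _ pair_finite_arcs]) (auto simp: colour_class_def)
  have "sym (parcs (colour_class G c k))"
    using pair_sym_arcs
    by (auto simp: colour_class_def symmetric_def sym_def insert_commute)
  then show ?thesis
    using fin pair_finite_verts
    by unfold_locales
      (auto simp: colour_class_def symmetric_def dest: arc_fst_in_verts arc_snd_in_verts pair_no_loops)
qed

lemma complete_digraph_complete_graph:
  "complete_digraph m (with_proj (complete_graph m))"
  unfolding complete_digraph_pair_def by (auto simp: complete_graph_def)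

lemma complete_bipartite_digraph_star_graph:
  assumes "1 \<le> n"
  shows "complete_bipartite_digraph 1 (n - 1) (with_proj (star_graph n))"
proof -
  have "finite (parcs (star_graph n))"
    by (rule finite_subset[of _ "{..<n} \<times> {..<n}"]) (auto simp: star_graph_def)
  then have "pair_graph (star_graph n)"
    by unfold_locales (auto simp: star_graph_def symmetric_def sym_def)
  then interpret pair_graph "star_graph n" .
  have "graph (with_proj (star_graph n))" by unfold_locales
  moreover have "\<exists>U V. verts (with_proj (star_graph n)) = U \<union> V \<and> U \<inter> V = {}
    \<and> card U = 1 \<and> card V = n - 1 \<and> arcs_ends (with_proj (star_graph n)) = U \<times> V \<union> V \<times> U"
    using assms
    by (intro exI[of _ "{0}"] exI[of _ "{1..<n}"]) (auto simp: star_graph_def)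
  ultimately show ?thesis unfolding complete_bipartite_digraph_def by blast
qed

lemma contains_copy_iff:
  assumes "pair_wf_digraph G" "pair_wf_digraph H"
  shows "contains_copy G H \<longleftrightarrow>
    (\<exists>f. inj_on f (pverts H) \<and> f ` pverts H \<subseteq> pverts G \<and>
         (\<forall>u v. (u, v) \<in> parcs H \<longrightarrow> (f u, f v) \<in> parcs G))"
    (is "?L \<longleftrightarrow> ?R")
proof
  assume ?L
  then obtain H' f where sub: "subgraph (with_proj H') (with_proj G)"
    and iso: "pre_digraph.digraph_isomorphism (with_proj H) f"
    and H': "with_proj H' = app_iso f (with_proj H)"
    unfolding contains_copy_def digraph_iso_def by blast
  have V: "pverts H' = iso_verts f ` pverts H" and A: "parcs H' = iso_arcs f ` parcs H"
    and t: "iso_tail f = fst" and h: "iso_head f = snd"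
    using H' by (auto simp: with_proj_def app_iso_def)
  have "inj_on (iso_verts f) (pverts H)"
    using iso by (simp add: pre_digraph.digraph_isomorphism_def)
  moreover have "iso_verts f ` pverts H \<subseteq> pverts G"
    using sub V by (auto simp: subgraph_def)
  moreover have "(iso_verts f u, iso_verts f v) \<in> parcs G" if "(u, v) \<in> parcs H" for u v
  proof -
    have "iso_verts f u = fst (iso_arcs f (u, v))" "iso_verts f v = snd (iso_arcs f (u, v))"
      using iso that by (auto simp: pre_digraph.digraph_isomorphism_def t h)
    then have "(iso_verts f u, iso_verts f v) = iso_arcs f (u, v)" by simp
    also have "\<dots> \<in> parcs H'" using A that by blast
    finally show ?thesis using sub by (auto simp: subgraph_def)
  qed
  ultimately show ?R by blast
next
  assume ?R
  then obtain f where inj: "inj_on f (pverts H)" and V: "f ` pverts H \<subseteq> pverts G"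
    and A: "\<And>u v. (u, v) \<in> parcs H \<Longrightarrow> (f u, f v) \<in> parcs G" by blast
  interpret G: pair_wf_digraph G by fact
  interpret H: pair_wf_digraph H by fact
  define H' where "H' = \<lparr> pverts = f ` pverts H, parcs = map_prod f f ` parcs H \<rparr>"
  define i where "i = \<lparr> iso_verts = f, iso_arcs = map_prod f f, iso_head = snd, iso_tail = fst \<rparr>"
  have "wf_digraph (with_proj H')"
    by unfold_locales (auto simp: H'_def dest: H.in_arcsD1 H.in_arcsD2)
  then have "subgraph (with_proj H') (with_proj G)"
    using V A G.wf_digraph by (auto simp: subgraph_def H'_def compatible_def)
  moreover have "inj_on (map_prod f f) (parcs H)"
    by (rule inj_on_subset[OF map_prod_inj_on[OF inj inj]]) (auto dest: H.in_arcsD1 H.in_arcsD2)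
  then have "pre_digraph.digraph_isomorphism (with_proj H) i"
    using inj H.wf_digraph by (auto simp: pre_digraph.digraph_isomorphism_def i_def)
  moreover have "with_proj H' = app_iso i (with_proj H)"
    by (simp add: with_proj_def app_iso_def H'_def i_def)
  ultimately show ?L
    unfolding contains_copy_def digraph_iso_def by blast
qed

end

theory Submission
  imports Defs
begin

text \<open>
  Let \<open>k = n - 1\<close> and suppose that red contains no \<open>T\<close>. Choose vertices of a blue clique greedily,
  each time discarding the chosen vertex \<open>v\<close> and everything that is not a blue neighbour of \<open>v\<close>.
  If at most \<open>(t + 1) * k\<close> vertices can always be discarded, then \<open>m\<close> steps succeed. Otherwise there
  is a set \<open>Y\<close> with \<open>card Y \<equiv> 1\<close> modulo \<open>k\<close> on which every vertex has red degree at least \<open>k - 1\<close>,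
  because it has at most \<open>t * k + 1\<close> non-neighbours in \<open>G\<close>.

  As \<open>T\<close> is not a star, it contains a path \<open>l, p, q, r\<close> that starts at a leaf \<open>l\<close>. All of \<open>T\<close> but \<open>l\<close>
  can be embedded greedily into red on \<open>Y\<close>. There is also room for \<open>l\<close> if \<open>p\<close> is sent to a vertex of
  degree at least \<open>k\<close>, or if \<open>p, q, r\<close> is sent to an induced path. So neither exists: red on \<open>Y\<close> is
  a disjoint union of cliques on \<open>k\<close> vertices, and \<open>k\<close> divides \<open>card Y\<close>, a contradiction.
\<close>

section \<open>Finite trees: connected subsets, long paths and stars\<close>

text \<open>Connectedness takes the form of the cut condition, which supplies the next vertex in
  every greedy step. Cycles are lists of at least 3 distinct vertices, so a single edge traversed
  back and forth does not count.\<close>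

locale finite_tree =
  fixes V :: "'b set" and E :: "('b \<times> 'b) set"
  assumes finite_V: "finite V"
    and E_subset: "E \<subseteq> V \<times> V"
    and sym_E: "sym E"
    and irrefl_E: "(x, x) \<notin> E"
    and cut: "S \<subseteq> V \<Longrightarrow> S \<noteq> {} \<Longrightarrow> S \<noteq> V \<Longrightarrow> \<exists>x\<in>S. \<exists>y\<in>V - S. (x, y) \<in> E"
    and no_cycle: "distinct xs \<Longrightarrow> 3 \<le> length xs \<Longrightarrow> successively (\<lambda>x y. (x, y) \<in> E) xs
      \<Longrightarrow> (last xs, hd xs) \<notin> E"
begin

abbreviation path :: "'b list \<Rightarrow> bool" where
  "path xs \<equiv> distinct xs \<and> successively (\<lambda>x y. (x, y) \<in> E) xs"

text \<open>The partial embeddings live on sets that induce subtrees. Paths inside \<open>S\<close>,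
  rather than cuts, express this because such a path can be closed to a cycle through a vertex
  outside \<open>S\<close>.\<close>

definition linked :: "'b set \<Rightarrow> bool" where
  "linked S \<longleftrightarrow> (\<forall>a\<in>S. \<forall>b\<in>S. \<exists>xs. path xs \<and> xs \<noteq> [] \<and> set xs \<subseteq> S \<and> hd xs = a \<and> last xs = b)"

lemma E_symD: "(x, y) \<in> E \<Longrightarrow> (y, x) \<in> E"
  using sym_E by (auto dest: symD)

lemma linked_singleton: "linked {a}"
  unfolding linked_def by (auto intro!: exI[of _ "[a]"])

lemma linked_insert:
  assumes S: "linked S" and x: "x \<in> S" and xy: "(x, y) \<in> E" and y: "y \<notin> S"
  shows "linked (insert y S)"
proof -
  have old: "\<exists>xs. path xs \<and> xs \<noteq> [] \<and> set xs \<subseteq> insert y S \<and> hd xs = a \<and> last xs = b"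
    if "a \<in> S" "b \<in> S" for a b
    using S that unfolding linked_def by blast
  have new: "\<exists>xs. path xs \<and> xs \<noteq> [] \<and> set xs \<subseteq> insert y S \<and> hd xs = y \<and> last xs = b"
    if b: "b \<in> S" for b
  proof -
    obtain xs where "path xs" "xs \<noteq> []" "set xs \<subseteq> S" "hd xs = x" "last xs = b"
      using S x b unfolding linked_def by blast
    then show ?thesis
      using y E_symD[OF xy] by (intro exI[of _ "y # xs"]) (auto simp: successively_Cons)
  qed
  have new': "\<exists>xs. path xs \<and> xs \<noteq> [] \<and> set xs \<subseteq> insert y S \<and> hd xs = b \<and> last xs = y"
    if b: "b \<in> S" for b
  proof -
    obtain xs where xs: "path xs" "xs \<noteq> []" "set xs \<subseteq> S" "hd xs = b" "last xs = x"
      using S x b unfolding linked_def by blast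
    then show ?thesis
      using y xy by (intro exI[of _ "xs @ [y]"]) (auto simp: successively_append_iff)
  qed
  have "\<exists>xs. path xs \<and> xs \<noteq> [] \<and> set xs \<subseteq> insert y S \<and> hd xs = y \<and> last xs = y"
    by (intro exI[of _ "[y]"]) auto
  with old new new' show ?thesis
    unfolding linked_def by blast
qed

text \<open>Two distinct neighbours of \<open>y\<close> are joined by a path in \<open>S\<close>
  with at least 2 vertices, and \<open>y\<close> closes it to a cycle.\<close>

lemma linked_unique_neighbour:
  assumes "linked S" "y \<notin> S" "a \<in> S" "b \<in> S" "(a, y) \<in> E" "(b, y) \<in> E"
  shows "a = b"
proof (rule ccontr)
  assume ab: "a \<noteq> b"
  obtain xs where xs: "path xs" "xs \<noteq> []" "set xs \<subseteq> S" "hd xs = a" "last xs = b"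
    using assms unfolding linked_def by blast
  have "2 \<le> length xs"
    using xs ab by (auto simp: Suc_le_eq numeral_2_eq_2 neq_Nil_conv split: if_splits)
  moreover have "path (y # xs)"
    using xs assms E_symD by (auto simp: successively_Cons)
  ultimately have "(last (y # xs), hd (y # xs)) \<notin> E"
    by (intro no_cycle) auto
  then show False using xs assms by auto
qed

lemma path_subset:
  assumes "path xs" "2 \<le> length xs"
  shows "set xs \<subseteq> V"
proof
  fix x assume "x \<in> set xs"
  then obtain as bs where eq: "xs = as @ x # bs" by (meson split_list)
  show "x \<in> V"
  proof (cases bs)
    case Nil
    then have "as \<noteq> []" using eq assms by auto
    then have "(last as, x) \<in> E" using eq assms by (auto simp: successively_append_iff)
    then show ?thesis using E_subset by auto
  next
    case (Cons b bs')
    then have "(x, b) \<in> E" using eq assms by (auto simp: successively_append_iff)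
    then show ?thesis using E_subset by auto
  qed
qed

text \<open>An end of a longest path is a leaf.\<close>

lemma leaf_at_end_of_long_path:
  assumes "path ys" "4 \<le> length ys"
  obtains l p q r where "path [l, p, q, r]" "\<And>w. (l, w) \<in> E \<Longrightarrow> w = p"
proof -
  let ?P = "\<lambda>xs. path xs \<and> 4 \<le> length xs"
  have bound: "length xs < Suc (card V)" if "?P xs" for xs
  proof -
    have "set xs \<subseteq> V" using path_subset that by auto
    then have "card (set xs) \<le> card V" using finite_V card_mono by blast
    then show ?thesis using that distinct_card[of xs] by simp
  qed
  obtain xs where xs: "?P xs" and max: "\<And>zs. ?P zs \<Longrightarrow> length zs \<le> length xs"
    using ex_has_greatest_nat[of ?P ys length "Suc (card V)"] assms bound by blast
  obtain l p q r zs where eq: "xs = l # p # q # r # zs"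
    using xs by (auto simp: numeral_eq_Suc Suc_le_length_iff)
  have leaf: "w = p" if w: "(l, w) \<in> E" for w
  proof (rule ccontr)
    assume wp: "w \<noteq> p"
    show False
    \<comment> \<open>A second neighbour \<open>w\<close> of \<open>l\<close> outside the path would
      prolong it; one on the path would close a cycle from \<open>l\<close> through \<open>p\<close>
      to \<open>w\<close>.\<close>
    proof (cases "w \<in> set xs")
      case False
      then have "?P (w # xs)" using xs w E_symD eq by (auto simp: successively_Cons)
      then show False using max[of "w # xs"] by simp
    next
      case True
      then have "w \<in> set (q # r # zs)" using eq wp w irrefl_E by auto
      then obtain as bs where "q # r # zs = as @ w # bs" by (meson split_list)
      then have eq': "xs = (l # p # as @ [w]) @ bs" using eq by simp
      then have "path (l # p # as @ [w])"
        using xs by (metis distinct_append successively_append_iff)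
      then have "(last (l # p # as @ [w]), hd (l # p # as @ [w])) \<notin> E"
        by (intro no_cycle) auto
      then show False using w E_symD by auto
    qed
  qed
  have "path [l, p, q, r]" using xs eq by auto
  then show thesis using leaf that by blast
qed

text \<open>A vertex \<open>c\<close> with two neighbours is adjacent to all others: an edge
  \<open>s\<close>, \<open>z\<close> leaving its closed neighbourhood would give the path
  \<open>z, s, c, b\<close> for another neighbour \<open>b\<close> of \<open>c\<close>. Further
  edges would form triangles with \<open>c\<close>.\<close>

lemma star_if_no_long_path:
  assumes card: "3 \<le> card V" and short: "\<And>xs. path xs \<Longrightarrow> length xs < 4"
  obtains c where "c \<in> V" "\<And>x y. (x, y) \<in> E \<longleftrightarrow> x \<in> V \<and> y \<in> V \<and> (x = c) \<noteq> (y = c)"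
proof -
  obtain u where u: "u \<in> V" using card by fastforce
  then obtain v where uv: "v \<in> V" "(u, v) \<in> E"
    using cut[of "{u}"] card by (cases "V = {u}") auto
  have "card {u, v} \<le> 2" by (simp add: card_insert_if)
  then have "{u, v} \<noteq> V" using card by auto
  then obtain x w where xw: "x \<in> {u, v}" "w \<in> V - {u, v}" "(x, w) \<in> E"
    using cut[of "{u, v}"] u uv by auto
  \<comment> \<open>The centre is whichever end of the edge \<open>u\<close>, \<open>v\<close> the
    third vertex \<open>w\<close> is attached to; \<open>a\<close> is the other end.\<close>
  obtain a c where ac: "(c, a) \<in> E" "(c, w) \<in> E" "a \<noteq> w"
    using xw uv E_symD by auto
  have all: "(c, y) \<in> E" if y: "y \<in> V" "y \<noteq> c" for y
  proof (rule ccontr)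
    assume "(c, y) \<notin> E"
    let ?S = "insert c {z. (c, z) \<in> E}"
    have "?S \<subseteq> V" "?S \<noteq> {}" "?S \<noteq> V"
      using ac E_subset y \<open>(c, y) \<notin> E\<close> by auto
    then obtain s z where s: "s \<in> ?S" "z \<in> V - ?S" "(s, z) \<in> E" using cut[of ?S] by blast
    then have cs: "(c, s) \<in> E" by auto
    obtain b where b: "(c, b) \<in> E" "b \<noteq> s" using ac by metis
    have "path [z, s, c, b]" using s cs b E_symD irrefl_E by auto
    then show False using short by fastforce
  qed
  have "(x, y) \<notin> E" if "x \<noteq> c" "y \<noteq> c" for x y
  proof
    assume xy: "(x, y) \<in> E"
    then have "(c, x) \<in> E" "(c, y) \<in> E" using all E_subset that by auto
    then have "(last [c, x, y], hd [c, x, y]) \<notin> E"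
      using xy that irrefl_E by (intro no_cycle) auto
    then show False using \<open>(c, y) \<in> E\<close> E_symD by auto
  qed
  then have "(x, y) \<in> E \<longleftrightarrow> x \<in> V \<and> y \<in> V \<and> (x = c) \<noteq> (y = c)" for x y
    using all E_symD E_subset irrefl_E by (cases "x = c"; cases "y = c") auto
  then show thesis using that ac E_subset by blast
qed

end

section \<open>Greedy embedding of a tree into a host graph\<close>

locale host_graph =
  fixes X :: "'a set" and R :: "('a \<times> 'a) set"
  assumes finite_X: "finite X"
    and sym_R: "sym R"
    and irrefl_R: "(x, x) \<notin> R"
begin

definition nbh :: "'a \<Rightarrow> 'a set" where
  "nbh v = {w \<in> X. (v, w) \<in> R}"

definition embeds :: "'b set \<Rightarrow> ('b \<times> 'b) set \<Rightarrow> ('b \<Rightarrow> 'a) \<Rightarrow> bool" where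
  "embeds S E f \<longleftrightarrow> inj_on f S \<and> f ` S \<subseteq> X \<and> (\<forall>u\<in>S. \<forall>v\<in>S. (u, v) \<in> E \<longrightarrow> (f u, f v) \<in> R)"

lemma finite_nbh: "finite (nbh v)"
  unfolding nbh_def using finite_X by auto

end

text \<open>Minimum degree \<open>k\<close> would suffice to embed any tree with \<open>k\<close>
  edges greedily. The bound here is one short, so only the last vertex can get stuck.\<close>

locale tree_in_host = finite_tree V E + host_graph X R
  for V :: "'b set" and E and X :: "'a set" and R +
  fixes k :: nat
  assumes card_V: "card V = k + 1"
    and nbh_ge: "v \<in> X \<Longrightarrow> k - 1 \<le> card (nbh v)"
begin

text \<open>Since \<open>x\<close> is the only neighbour of \<open>y\<close> in \<open>S\<close>,
  the edge from \<open>f x\<close> to \<open>z\<close> is the only new one to check.\<close>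

lemma embeds_insert:
  assumes "linked S" "y \<notin> S" "x \<in> S" "(x, y) \<in> E"
    and f: "embeds S E f" and z: "z \<in> X" "z \<notin> f ` S" "(f x, z) \<in> R"
  shows "embeds (insert y S) E (f(y := z))"
proof -
  have "u = x" if "u \<in> S" "(u, y) \<in> E \<or> (y, u) \<in> E" for u
    using linked_unique_neighbour[of S y u x] assms that E_symD by blast
  moreover have "(z, f x) \<in> R" using z sym_R by (auto dest: symD)
  moreover have "inj_on (f(y := z)) (insert y S)"
    using f z \<open>y \<notin> S\<close> unfolding embeds_def by (auto simp: inj_on_fun_updI)
  ultimately show ?thesis
    using f z \<open>y \<notin> S\<close> irrefl_E unfolding embeds_def by auto
qed

text \<open>While \<open>S\<close> is a proper subset of \<open>V - {l}\<close>, it has fewer than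
  \<open>k\<close> vertices. One of them is mapped to \<open>f x\<close>, so at most
  \<open>k - 2\<close> of the at least \<open>k - 1\<close> neighbours of \<open>f x\<close> are
  occupied.\<close>

lemma embeds_extend_to_leaf:
  assumes l: "l \<in> V" and leaf: "\<And>w. (l, w) \<in> E \<Longrightarrow> w = p"
  shows "linked S \<Longrightarrow> p \<in> S \<Longrightarrow> S \<subseteq> V - {l} \<Longrightarrow> embeds S E f
    \<Longrightarrow> \<exists>g. linked (V - {l}) \<and> embeds (V - {l}) E g \<and> (\<forall>u\<in>S. g u = f u)"
proof (induction "card (V - S)" arbitrary: S f rule: less_induct)
  case less
  show ?case
  proof (cases "S = V - {l}")
    case True
    then show ?thesis using less.prems by auto
  next
    case False
    have fS: "finite S" using less.prems finite_V finite_subset by blast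
    \<comment> \<open>Adding \<open>l\<close> to the cut reserves it for the end. The edge found
      cannot start at \<open>l\<close>, whose only neighbour \<open>p\<close> is already in
      \<open>S\<close>.\<close>
    have "insert l S \<subseteq> V" "insert l S \<noteq> V" using less.prems l False by auto
    then obtain x y where xy: "x \<in> insert l S" "y \<in> V - insert l S" "(x, y) \<in> E"
      using cut[of "insert l S"] by blast
    then have x: "x \<in> S" using leaf less.prems by auto
    have "card S < card (V - {l})"
      using less.prems False finite_V by (intro psubset_card_mono) auto
    then have cS: "card S < k" "0 < card S"
      using card_V l finite_V x fS by (auto simp: card_gt_0_iff)
    have fx: "f x \<in> X" "inj_on f S" using x less.prems unfolding embeds_def by auto
    have "\<not> nbh (f x) \<subseteq> f ` S - {f x}"
    proof
      assume "nbh (f x) \<subseteq> f ` S - {f x}"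
      then have "card (nbh (f x)) \<le> card (f ` S - {f x})" using fS by (intro card_mono) auto
      also have "\<dots> = card S - 1" using fS fx x by (simp add: card_image)
      also have "\<dots> < k - 1" using cS by linarith
      finally show False using nbh_ge fx by force
    qed
    then obtain z where z: "z \<in> X" "z \<notin> f ` S" "(f x, z) \<in> R"
      unfolding nbh_def using irrefl_R by blast
    let ?f = "f(y := z)"
    have "embeds (insert y S) E ?f" using embeds_insert[of S y x f z] less.prems xy x z by auto
    moreover have "linked (insert y S)" using linked_insert less.prems xy x by auto
    moreover have "card (V - insert y S) < card (V - S)"
      using xy finite_V by (intro psubset_card_mono) auto
    ultimately obtain g where "linked (V - {l})" "embeds (V - {l}) E g" "\<forall>u\<in>insert y S. g u = ?f u"
      using less.hyps[of "insert y S" ?f] less.prems xy by auto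
    then show ?thesis using xy by (intro exI[of _ g]) auto
  qed
qed

text \<open>A set \<open>B\<close> of vertices in the image of \<open>S\<close> outside the neighbourhood of \<open>f p\<close> leaves room
  there for the leaf \<open>l\<close>, which is embedded last.\<close>

lemma embeds_tree:
  assumes lp: "(l, p) \<in> E" and leaf: "\<And>w. (l, w) \<in> E \<Longrightarrow> w = p"
    and S: "linked S" "p \<in> S" "S \<subseteq> V - {l}" "embeds S E f"
    and B: "B \<subseteq> f ` S" "B \<inter> nbh (f p) = {}" "k < card (nbh (f p)) + card B"
  shows "\<exists>g. embeds V E g"
proof -
  have l: "l \<in> V" "p \<in> V" using lp E_subset by auto
  obtain g where g: "linked (V - {l})" "embeds (V - {l}) E g" "\<forall>u\<in>S. g u = f u"
    using embeds_extend_to_leaf[OF l(1) leaf S] by auto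
  let ?I = "g ` (V - {l})"
  have "card ?I = k"
    using g l finite_V card_V unfolding embeds_def by (simp add: card_image)
  moreover have BI: "B \<subseteq> ?I"
  proof
    fix b assume "b \<in> B"
    then obtain u where "u \<in> S" "b = g u" using B(1) g(3) by auto
    then show "b \<in> ?I" using S(3) by auto
  qed
  moreover have finI: "finite ?I" using finite_V by simp
  ultimately have "card (?I - B) = k - card B" "card B \<le> k"
    using card_mono[OF finI BI] by (auto simp: card_Diff_subset finite_subset)
  \<comment> \<open>As \<open>g p = f p\<close>, the occupied neighbours of \<open>g p\<close> all
    lie in \<open>?I - B\<close>, so some neighbour is free for \<open>l\<close>.\<close>
  then have "card (?I - B) < card (nbh (f p))" using B(3) by linarith
  then have "\<not> nbh (f p) \<subseteq> ?I - B" using finI by (meson card_mono finite_Diff not_le)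
  then obtain z where z: "z \<in> X" "z \<notin> ?I" "(g p, z) \<in> R"
    using B(2) g(3) S(2) unfolding nbh_def by auto
  have "p \<noteq> l" using lp irrefl_E by auto
  then have "embeds (insert l (V - {l})) E (g(l := z))"
    using g z l E_symD[OF lp] by (intro embeds_insert[where x = p]) auto
  then show ?thesis using l by (auto simp: insert_absorb)
qed

lemma dvd_card_if_not_embeds:
  assumes lpqr: "path [l, p, q, r]" and leaf: "\<And>w. (l, w) \<in> E \<Longrightarrow> w = p"
    and none: "\<nexists>g. embeds V E g"
  shows "k dvd card X"
proof -
  have edges: "(l, p) \<in> E" "(p, q) \<in> E" "(q, r) \<in> E" and dist: "distinct [l, p, q, r]"
    using lpqr by auto
  have V: "{l, p, q, r} \<subseteq> V" using path_subset[OF lpqr] by simp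
  have "4 \<le> card V" using card_mono[OF finite_V V] dist by simp
  then have k: "3 \<le> k" using card_V by simp
  \<comment> \<open>A vertex \<open>v\<close> of degree at least \<open>k\<close> can host
    \<open>p\<close>: being occupied but not its own neighbour, it already serves as
    \<open>B\<close>.\<close>
  have deg: "card (nbh v) = k - 1" if v: "v \<in> X" for v
  proof (rule ccontr)
    assume "card (nbh v) \<noteq> k - 1"
    then have "k \<le> card (nbh v)" using nbh_ge[OF v] by simp
    then have "\<exists>g. embeds V E g"
      using v irrefl_R irrefl_E V dist edges
      by (intro embeds_tree[where l = l and p = p and S = "{p}" and f = "\<lambda>_. v" and B = "{v}"] leaf)
        (auto simp: linked_singleton embeds_def nbh_def)
    with none show False ..
  qed
  \<comment> \<open>If \<open>v, x, y\<close> were an induced path, it could host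
    \<open>p, q, r\<close>. Then \<open>B = {v, y}\<close> consists of two non-neighbours of
    \<open>v\<close>, and \<open>(k - 1) + 2\<close> exceeds \<open>k\<close>.\<close>
  have trans: "(v, y) \<in> R"
    if X: "v \<in> X" "x \<in> X" "y \<in> X" and R: "(v, x) \<in> R" "(x, y) \<in> R" and "v \<noteq> y" for v x y
  proof (rule ccontr)
    assume vy: "(v, y) \<notin> R"
    let ?f = "(\<lambda>_. v)(q := x, r := y)"
    have xv: "x \<noteq> v" "x \<noteq> y" using R irrefl_R by auto
    have lp: "linked {p}" by (rule linked_singleton)
    have lq: "linked (insert q {p})" using lp by (rule linked_insert[where x = p]) (use edges dist in auto)
    have lr: "linked (insert r (insert q {p}))"
      using lq by (rule linked_insert[where x = q]) (use edges dist in auto)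
    have ep: "embeds {p} E (\<lambda>_. v)" using X irrefl_E by (auto simp: embeds_def)
    have eq: "embeds (insert q {p}) E ((\<lambda>_. v)(q := x))"
      by (rule embeds_insert[OF lp _ _ _ ep, where x = p]) (use edges dist R X xv in auto)
    have er: "embeds (insert r (insert q {p})) E ?f"
      by (rule embeds_insert[OF lq _ _ _ eq, where x = q]) (use edges dist R X xv \<open>v \<noteq> y\<close> in auto)
    have "\<exists>g. embeds V E g"
    proof (rule embeds_tree[OF edges(1) leaf lr _ _ er])
      show "{v, y} \<subseteq> ?f ` insert r (insert q {p})" using dist by auto
      show "{v, y} \<inter> nbh (?f p) = {}" using vy irrefl_R dist by (auto simp: nbh_def)
      show "k < card (nbh (?f p)) + card {v, y}" using deg[OF X(1)] \<open>v \<noteq> y\<close> dist k by simp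
    qed (use V dist in auto)
    with none show False ..
  qed
  \<comment> \<open>The classes of \<open>Q\<close> are the closed neighbourhoods, each with
    \<open>(k - 1) + 1\<close> vertices.\<close>
  define Q where "Q = {(u, v) \<in> X \<times> X. u = v \<or> (u, v) \<in> R}"
  have "sym Q" using sym_R by (auto simp: Q_def sym_def)
  moreover have "trans Q" using trans by (intro transI) (auto simp: Q_def)
  ultimately have "equiv X Q"
    by (intro equivI) (auto simp: Q_def refl_on_def)
  moreover have "k dvd card C" if "C \<in> X // Q" for C
  proof -
    from that obtain v where v: "v \<in> X" "C = Q `` {v}" by (auto elim: quotientE)
    then have "C = insert v (nbh v)" by (auto simp: Q_def nbh_def)
    moreover have "v \<notin> nbh v" using irrefl_R by (auto simp: nbh_def)
    ultimately have "card C = k" using deg[OF v(1)] finite_nbh k by simp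
    then show ?thesis by simp
  qed
  ultimately show ?thesis using equiv_imp_dvd_card[OF finite_X] by blast
qed

end

section \<open>Undirected trees and stars as symmetric digraphs\<close>

lemma finite_tree_undirected_tree:
  assumes "undirected_tree T"
  shows "finite_tree (pverts T) (parcs T)"
proof -
  interpret pair_graph T using assms by (simp add: undirected_tree_def)
  have cn: "connected (with_proj T)"
    and cyc: "\<And>p. pre_digraph.cycle (with_proj T) p \<Longrightarrow> \<not> 3 \<le> length p"
    using assms by (auto simp: undirected_tree_def)
  \<comment> \<open>\<open>connected\<close> refers to the symmetric closure, which leaves
    reachability unchanged because the arcs are already symmetric.\<close>
  have reach: "u \<rightarrow>\<^sup>*\<^bsub>with_proj T\<^esub> v" if "u \<in> pverts T" "v \<in> pverts T" for u v
    using cn that sym_arcs reachable_mk_symmetric_eq by (auto simp: connected_def strongly_connected_def)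
  show ?thesis
  proof
    show "finite (pverts T)" by simp
    show "parcs T \<subseteq> pverts T \<times> pverts T" by (auto dest: in_arcsD1 in_arcsD2)
    show "sym (parcs T)" using pair_sym_arcs by (simp add: symmetric_def)
    show "(x, x) \<notin> parcs T" for x using pair_no_loops[of "(x, x)"] by auto
  next
    fix S assume S: "S \<subseteq> pverts T" "S \<noteq> {}" "S \<noteq> pverts T"
    then obtain a b where ab: "a \<in> S" "b \<in> pverts T - S" by blast
    show "\<exists>x\<in>S. \<exists>y\<in>pverts T - S. (x, y) \<in> parcs T"
    proof (rule ccontr)
      assume no: "\<not> ?thesis"
      have "a \<rightarrow>\<^sup>*\<^bsub>with_proj T\<^esub> b" using reach ab S by blast
      then have "b \<in> S"
      proof (induction rule: reachable_induct)
        case (step x y)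
        then have "(x, y) \<in> parcs T" by auto
        then show ?case using no step.IH in_arcsD2 by blast
      qed (rule ab)
      then show False using ab by simp
    qed
  next
    fix xs assume xs: "distinct xs" "3 \<le> length xs" "successively (\<lambda>x y. (x, y) \<in> parcs T) xs"
    show "(last xs, hd xs) \<notin> parcs T"
    proof
      assume closing: "(last xs, hd xs) \<in> parcs T"
      have walk: "cas x (vwalk_arcs (x # ys)) (last (x # ys)) \<and> awalk_verts x (vwalk_arcs (x # ys)) = x # ys"
        for x ys by (induction ys arbitrary: x) auto
      have arcs: "set (vwalk_arcs zs) \<subseteq> parcs T"
        if "successively (\<lambda>x y. (x, y) \<in> parcs T) zs" for zs
        using that by (induction zs rule: vwalk_arcs.induct) auto
      have len: "length (vwalk_arcs zs) = length zs - 1" for zs :: "'a list"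
        by (induction zs rule: vwalk_arcs.induct) auto
      obtain x ys where eq: "xs = x # ys" using xs by (cases xs) auto
      \<comment> \<open>Repeating \<open>x\<close> closes the walk. It has as many arcs as
        \<open>xs\<close> has vertices, and only its start is repeated, so it is a forbidden
        cycle.\<close>
      let ?p = "vwalk_arcs (x # ys @ [x])"
      have "successively (\<lambda>x y. (x, y) \<in> parcs T) ((x # ys) @ [x])"
        using xs(3) closing unfolding eq successively_append_iff by auto
      then have "set ?p \<subseteq> parcs T" using arcs by force
      moreover have "x \<in> pverts T" using closing eq by (auto dest: in_arcsD2)
      ultimately have "awalk x ?p x" using walk[of x "ys @ [x]"] by (auto simp: awalk_def)
      moreover have "distinct (tl (awalk_verts x ?p))"
        using walk[of x "ys @ [x]"] xs eq by auto
      moreover have "length ?p = length xs" using len[of "x # ys @ [x]"] eq by simp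
      moreover have "?p \<noteq> []" using \<open>length ?p = length xs\<close> xs by (metis eq length_0_conv list.simps(3))
      ultimately show False using cyc[of ?p] xs unfolding cycle_def by auto
    qed
  qed
qed

lemma digraph_iso_star_graph:
  fixes T :: "'b pair_pre_digraph"
  assumes "pair_graph T" "card (pverts T) = n" "c \<in> pverts T"
    and arcs: "\<And>x y. (x, y) \<in> parcs T \<longleftrightarrow> x \<in> pverts T \<and> y \<in> pverts T \<and> (x = c) \<noteq> (y = c)"
  shows "digraph_iso (with_proj T) (with_proj (star_graph n))"
proof -
  interpret pair_graph T by fact
  obtain h where h: "bij_betw h (pverts T) {0..<n}"
    using ex_bij_betw_finite_nat[of "pverts T"] assms by auto
  \<comment> \<open>The enumeration \<open>h\<close> is arbitrary; the transposition moves the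
    centre to 0, as \<open>star_graph\<close> requires.\<close>
  define f where "f = Transposition.transpose 0 (h c) \<circ> h"
  have hc: "h c < n" using h assms bij_betwE by fastforce
  have "bij_betw (Transposition.transpose 0 (h c)) {0..<n} {0..<n}"
    using hc by (intro bij_betw_transpose_iff) auto
  then have f: "bij_betw f (pverts T) {0..<n}"
    unfolding f_def using h bij_betw_trans by blast
  have fc: "f c = 0" by (simp add: f_def)
  have inj: "inj_on f (pverts T)" and img: "f ` pverts T = {..<n}"
    using f by (auto simp: bij_betw_def atLeast0LessThan)
  have f0: "f x = 0 \<longleftrightarrow> x = c" if "x \<in> pverts T" for x
    using inj fc that assms by (metis inj_onD)
  define i where "i = \<lparr> iso_verts = f, iso_arcs = map_prod f f, iso_head = snd, iso_tail = fst \<rparr>"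
  have "inj_on (map_prod f f) (parcs T)"
    by (rule inj_on_subset[OF map_prod_inj_on[OF inj inj]]) (auto dest: in_arcsD1 in_arcsD2)
  then have "digraph_isomorphism i"
    using inj wf_digraph by (auto simp: digraph_isomorphism_def i_def)
  moreover have "map_prod f f ` parcs T = parcs (star_graph n)"
  proof (intro equalityI subsetI)
    fix e assume "e \<in> map_prod f f ` parcs T"
    then obtain x y where "(x, y) \<in> parcs T" "e = (f x, f y)" by auto
    moreover from this have xy: "x \<in> pverts T" "y \<in> pverts T" "(x = c) \<noteq> (y = c)"
      using arcs by auto
    moreover have "f x < n" "f y < n" using xy img by auto
    ultimately show "e \<in> parcs (star_graph n)" using f0[of x] f0[of y] by (auto simp: star_graph_def)
  next
    fix e assume e: "e \<in> parcs (star_graph n)"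
    obtain u v where uv: "e = (u, v)" by (cases e)
    then have "u \<in> f ` pverts T" "v \<in> f ` pverts T" using e img by (auto simp: star_graph_def)
    then obtain x y where xy: "x \<in> pverts T" "y \<in> pverts T" "u = f x" "v = f y" by auto
    then have "(x, y) \<in> parcs T" using e uv f0[of x] f0[of y] unfolding arcs by (auto simp: star_graph_def)
    then show "e \<in> map_prod f f ` parcs T" using uv xy by (auto intro: rev_image_eqI)
  qed
  then have "with_proj (star_graph n) = app_iso i (with_proj T)"
    using img by (simp add: with_proj_def app_iso_def i_def star_graph_def)
  ultimately show ?thesis unfolding digraph_iso_def by blast
qed

section \<open>Greedy cliques and counting of non-neighbours\<close>

text \<open>Each step costs at most \<open>D\<close> vertices, \<open>v\<close> itself included. The
  hypothesis \<open>few\<close> is restricted to sets of size 1 modulo \<open>D\<close>, so that its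
  failure can be refuted by divisibility.\<close>

lemma greedy_clique:
  assumes "finite X" and sym: "sym B" and irrefl: "\<And>v. (v, v) \<notin> B"
    and few: "\<And>Y i. Y \<subseteq> X \<Longrightarrow> card Y = D * Suc i + 1 \<Longrightarrow> \<exists>v\<in>Y. card {w \<in> Y. (v, w) \<notin> B} \<le> D"
  shows "Y \<subseteq> X \<Longrightarrow> D * j + 1 \<le> card Y
    \<Longrightarrow> \<exists>K\<subseteq>Y. card K = Suc j \<and> (\<forall>u\<in>K. \<forall>v\<in>K. u \<noteq> v \<longrightarrow> (u, v) \<in> B)"
proof (induction j arbitrary: Y)
  case 0
  then obtain v where "v \<in> Y" by fastforce
  then show ?case by (intro exI[of _ "{v}"]) auto
next
  case (Suc j)
  \<comment> \<open>Trimming to the exact size makes \<open>few\<close> applicable.\<close>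
  obtain Z where Z: "Z \<subseteq> Y" "card Z = D * Suc j + 1"
    using obtain_subset_with_card_n[OF Suc.prems(2)] by blast
  then have fZ: "finite Z" using Suc.prems(1) \<open>finite X\<close> by (meson finite_subset)
  obtain v where v: "v \<in> Z" "card {w \<in> Z. (v, w) \<notin> B} \<le> D"
    using few[of Z j] Z Suc.prems by auto
  let ?W = "{w \<in> Z. (v, w) \<in> B}"
  have "card Z = card ?W + card {w \<in> Z. (v, w) \<notin> B}"
    using fZ by (subst card_Un_disjoint[symmetric]) (auto intro: arg_cong[where f = card])
  then have "D * j + 1 \<le> card ?W" using v Z by simp
  moreover have "?W \<subseteq> X" using Z Suc.prems by auto
  ultimately obtain K where K: "K \<subseteq> ?W" "card K = Suc j"
    "\<forall>u\<in>K. \<forall>v\<in>K. u \<noteq> v \<longrightarrow> (u, v) \<in> B"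
    using Suc.IH[of ?W] by auto
  have "finite K" using K fZ finite_subset by fastforce
  moreover have "v \<notin> K" using K irrefl by auto
  ultimately have "card (insert v K) = Suc (Suc j)" using K by simp
  moreover have "insert v K \<subseteq> Y" using K Z v by auto
  ultimately show ?case
    using K sym by (intro exI[of _ "insert v K"]) (auto dest: symD)
qed

text \<open>The vertex \<open>v\<close> counts among its own non-neighbours here, so the neighbours
  are exactly the complement.\<close>

lemma card_non_neighbours_le:
  assumes "pair_graph G" "v \<in> pverts G"
  shows "card {w \<in> pverts G. (v, w) \<notin> parcs G} + min_degree (with_proj G) \<le> card (pverts G)"
proof -
  interpret pair_graph G by fact
  let ?N = "{w \<in> pverts G. (v, w) \<in> parcs G}"
  have "out_arcs (with_proj G) v = Pair v ` ?N"
    by (auto simp: out_arcs_def dest: in_arcsD2)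
  then have "out_degree (with_proj G) v = card ?N"
    by (simp add: out_degree_def card_image inj_on_def)
  moreover have "min_degree (with_proj G) \<le> out_degree (with_proj G) v"
    unfolding min_degree_def using assms by (intro Min_le) auto
  moreover have "card (pverts G) = card ?N + card {w \<in> pverts G. (v, w) \<notin> parcs G}"
    by (subst card_Un_disjoint[symmetric]) (auto intro: arg_cong[where f = card])
  ultimately show ?thesis by simp
qed

theorem theorem3p4:
  fixes n m N t :: nat
    and T :: "'b pair_pre_digraph"
    and G :: "'a pair_pre_digraph"
  assumes "n \<ge> 1" and "m \<ge> 1" and "N \<ge> 1"
    and "(t + 1) * (n - 1) * (m - 1) + 1 \<le> N"
    and "N \<le> (t + 2) * (n - 1) * (m - 1)"
    and "undirected_tree T" and "card (pverts T) = n"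
    and "pair_graph G" and "card (pverts G) = N"
    and "int (min_degree (with_proj G)) \<ge> int N - int t * (int n - 1) - 2"
    and "\<not> [int m - 2 = 0] (mod (int n - 1))"
    and "\<not> digraph_iso (with_proj T) (with_proj (star_graph n))"
  shows "arrows G T (complete_graph m)"
  unfolding arrows_def
proof (intro allI disjCI)
  fix c
  assume no_blue: "\<not> contains_copy (colour_class G c Blue) (complete_graph m)"
  show "contains_copy (colour_class G c Red) T"
  proof (rule ccontr)
    assume no_red: "\<not> ?thesis"
    define k where "k = n - 1"
    let ?R = "parcs (colour_class G c Red)" and ?B = "parcs (colour_class G c Blue)"
    interpret G: pair_graph G by fact
    interpret R: pair_graph "colour_class G c Red" using pair_graph_colour_class assms by blast
    interpret B: pair_graph "colour_class G c Blue" using pair_graph_colour_class assms by blast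
    interpret T: pair_graph T using assms by (simp add: undirected_tree_def)
    interpret T: finite_tree "pverts T" "parcs T" by (rule finite_tree_undirected_tree) fact
    have pair_wf_K: "pair_wf_digraph (complete_graph m)"
      by unfold_locales (auto simp: complete_graph_def)
    \<comment> \<open>For \<open>n = 1\<close> the bounds on \<open>N\<close> become 1 and 0. For
      \<open>n = 2\<close> the modulus is 1, so the excluded congruence would hold.\<close>
    have "n \<noteq> 1" using assms by auto
    moreover have "n \<noteq> 2" using assms by (auto simp: cong_def)
    ultimately have n: "3 \<le> n" using assms by simp
    then have k: "2 \<le> k" "n = k + 1" unfolding k_def by auto
    obtain xs where "T.path xs" "4 \<le> length xs"
    proof (rule ccontr)
      assume "\<not> thesis"
      then have "\<And>xs. T.path xs \<Longrightarrow> length xs < 4" using that by (meson not_le)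
      then obtain a where "a \<in> pverts T"
        "\<And>x y. (x, y) \<in> parcs T \<longleftrightarrow> x \<in> pverts T \<and> y \<in> pverts T \<and> (x = a) \<noteq> (y = a)"
        using T.star_if_no_long_path assms n by metis
      then show False using digraph_iso_star_graph[OF T.pair_graph] assms by blast
    qed
    then obtain l p q r where lpqr: "T.path [l, p, q, r]" "\<And>w. (l, w) \<in> parcs T \<Longrightarrow> w = p"
      using T.leaf_at_end_of_long_path by metis
    have non_nbrs: "card {w \<in> pverts G. (v, w) \<notin> parcs G} \<le> t * k + 2" if "v \<in> pverts G" for v
    proof -
      have "int N \<le> int (min_degree (with_proj G)) + int (t * k + 2)"
        using assms k by simp
      then show ?thesis using card_non_neighbours_le[OF G.pair_graph that] assms by linarith
    qed
    have few: "\<exists>v\<in>Y. card {w \<in> Y. (v, w) \<notin> ?B} \<le> (t + 1) * k"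
      if Y: "Y \<subseteq> pverts G" "card Y = (t + 1) * k * Suc i + 1" for Y i
    proof (rule ccontr)
      assume many: "\<not> ?thesis"
      have fY: "finite Y" using Y finite_subset G.pair_finite_verts by blast
      interpret Y: host_graph Y ?R
      proof unfold_locales
        show "sym ?R" using R.pair_sym_arcs by (simp add: symmetric_def)
        show "(x, x) \<notin> ?R" for x using R.pair_no_loops[of "(x, x)"] by auto
      qed (rule fY)
      interpret TY: tree_in_host "pverts T" "parcs T" Y ?R k
      proof unfold_locales
        show "card (pverts T) = k + 1" using assms k by simp
        fix v assume v: "v \<in> Y"
        \<comment> \<open>More than \<open>(t + 1) * k\<close> vertices of \<open>Y\<close> are not
          blue neighbours of \<open>v\<close>, and at most \<open>t * k + 2\<close> are
          non-neighbours in \<open>G\<close>; both counts include \<open>v\<close>. Hence more than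
          \<open>k - 2\<close> are red neighbours.\<close>
        have "{w \<in> Y. (v, w) \<notin> ?B} \<subseteq> {w \<in> pverts G. (v, w) \<notin> parcs G} \<union> Y.nbh v"
        proof
          fix w assume "w \<in> {w \<in> Y. (v, w) \<notin> ?B}"
          then show "w \<in> {w \<in> pverts G. (v, w) \<notin> parcs G} \<union> Y.nbh v"
            unfolding Y.nbh_def using Y(1)
            by (cases "c {v, w}") (auto simp: colour_class_def)
        qed
        then have "card {w \<in> Y. (v, w) \<notin> ?B}
            \<le> card ({w \<in> pverts G. (v, w) \<notin> parcs G} \<union> Y.nbh v)"
          using Y.finite_nbh by (intro card_mono) auto
        also have "\<dots> \<le> card {w \<in> pverts G. (v, w) \<notin> parcs G} + card (Y.nbh v)"
          by (rule card_Un_le)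
        also have "\<dots> \<le> t * k + 2 + card (Y.nbh v)" using non_nbrs v Y by auto
        finally show "k - 1 \<le> card (Y.nbh v)" using many v by force
      qed
      have "\<nexists>g. Y.embeds (pverts T) (parcs T) g"
      proof
        assume "\<exists>g. Y.embeds (pverts T) (parcs T) g"
        then obtain g where g: "Y.embeds (pverts T) (parcs T) g" by auto
        have "(g u, g v) \<in> ?R" if "(u, v) \<in> parcs T" for u v
          using g that subsetD[OF T.E_subset that] by (simp add: Y.embeds_def)
        moreover have "inj_on g (pverts T)" "g ` pverts T \<subseteq> pverts (colour_class G c Red)"
          using g Y(1) unfolding Y.embeds_def by (auto simp: colour_class_def)
        ultimately have "contains_copy (colour_class G c Red) T"
          unfolding contains_copy_iff[OF R.pair_wf_digraph T.pair_wf_digraph]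
          by (intro exI[of _ g] conjI allI impI)
        with no_red show False ..
      qed
      then have "k dvd card Y" using lpqr by (intro TY.dvd_card_if_not_embeds) auto
      moreover have "k dvd (t + 1) * k * Suc i" by simp
      \<comment> \<open>Here the choice of \<open>card Y\<close> as 1 modulo \<open>k\<close> pays
        off.\<close>
      ultimately have "k dvd 1" unfolding Y(2) by (simp only: dvd_add_right_iff)
      then show False using k by simp
    qed
    \<comment> \<open>The first vertex needs only a nonempty set, so \<open>m\<close> vertices take
      \<open>m - 1\<close> reductions; the lower bound on \<open>N\<close> allows exactly
      that.\<close>
    have "\<exists>K\<subseteq>pverts G. card K = Suc (m - 1) \<and> (\<forall>u\<in>K. \<forall>v\<in>K. u \<noteq> v \<longrightarrow> (u, v) \<in> ?B)"
    proof (rule greedy_clique[OF G.pair_finite_verts _ _ few])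
      show "sym ?B" using B.pair_sym_arcs by (simp add: symmetric_def)
      show "(v, v) \<notin> ?B" for v using B.pair_no_loops[of "(v, v)"] by auto
      show "(t + 1) * k * (m - 1) + 1 \<le> card (pverts G)" using assms by (simp add: k_def)
    qed auto
    then obtain K where K: "K \<subseteq> pverts G" "card K = m" "\<forall>u\<in>K. \<forall>v\<in>K. u \<noteq> v \<longrightarrow> (u, v) \<in> ?B"
      using assms by auto
    then have "finite K" using finite_subset G.pair_finite_verts by blast
    then obtain h where h: "bij_betw h {0..<m} K" using ex_bij_betw_nat_finite K by metis
    have "contains_copy (colour_class G c Blue) (complete_graph m)"
      unfolding contains_copy_iff[OF B.pair_wf_digraph pair_wf_K]
    proof (intro exI[of _ h] conjI allI impI)
      show "inj_on h (pverts (complete_graph m))"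
        using h by (simp add: complete_graph_def bij_betw_def atLeast0LessThan)
      show "h ` pverts (complete_graph m) \<subseteq> pverts (colour_class G c Blue)"
        using h K by (simp add: complete_graph_def colour_class_def bij_betw_def atLeast0LessThan)
      fix u v assume "(u, v) \<in> parcs (complete_graph m)"
      then have "u \<in> {0..<m}" "v \<in> {0..<m}" "u \<noteq> v" by (auto simp: complete_graph_def)
      then have "h u \<in> K" "h v \<in> K" "h u \<noteq> h v"
        using h by (auto simp: bij_betw_def inj_on_eq_iff)
      then show "(h u, h v) \<in> ?B" using K by blast
    qed
    with no_blue show False ..
  qed
qed

end
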